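(* For integers $p\ge2$, $m\ge0$ and $x\in[-1,1)$, \begin{align*} &(-1)^p\sum_{n=1}^\infty\left\{\frac{\zeta_n(p+2m+1)}{n^p}+\frac{\zeta_n(p)}{n^{p+2m+1}}\right\}\left(\sum_{k=1}^n\frac{x^k}{k}\right)\\ &=(p+2m+2)I_{p-1,p+2m+2}(x)+(2m+1)I_{p,p+2m+1}(x)-(p+1)I_{p+1,p+2m}(x)\\ &\quad+(-1)^p\ln(1-x)\sum_{n=1}^\infty\left\{\frac{\zeta_n(p+2m+1)}{n^p}+\frac{\zeta_n(p)}{n^{p+2m+1}}\right\}(x^n-1)\\ &\quad+\sum_{i=1}^{p+2m}(-1)^{i-1}\mathrm{Li}_{p+2m+2-i}(x)\sum_{n=1}^\infty\left\{\sum_{j=2}^{p-1}\frac{\zeta_n(j)}{n^{p+i-j}}+2\frac{H_n}{n^{p+i-1}}\right\}x^n\\ &\quad+\sum_{i=1}^{p+2m-1}(-1)^{i-1}\mathrm{Li}_{p+2m+1-i}(x)\sum_{n=1}^\infty\left\{\sum_{j=2}^{p}\frac{\zeta_n(j)}{n^{p+1+i-j}}+2\frac{H_n}{n^{p+i}}\right\}x^n\\ &\quad-\sum_{i=1}^{p-2}(-1)^{i-1}\mathrm{Li}_{p-i}(x)\sum_{n=1}^\infty\left\{\sum_{j=2}^{p+2m+1}\frac{\zeta_n(j)}{n^{p+2m+2+i-j}}+2\frac{H_n}{n^{p+2m+1+i}}\right\}x^n\\ &\quad-\sum_{i=1}^{p-1}(-1)^{i-1}\mathrm{Li}_{p+1-i}(x)\sum_{n=1}^\infty\left\{\sum_{j=2}^{p+2m}\frac{\zeta_n(j)}{n^{p+2m+1+i-j}}+2\frac{H_n}{n^{p+2m+i}}\right\}x^n.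 \end{align*}
   Context: $H_n=\sum_{j=1}^n1/j$, $\zeta_n(k)=\sum_{j=1}^nj^{-k}$, $\mathrm{Li}_p(x)=\sum_{n\ge1}x^n/n^p$ (with $\mathrm{Li}_1(x)=-\ln(1-x)$), and for integers $a,b\ge1$, $I_{a,b}(x)=\int_0^x\frac{\mathrm{Li}_a(t)\mathrm{Li}_b(t)}{t}dt$. Empty sums are zero. *)

theory Defs
  imports "HOL-Analysis.Analysis"
begin

definition zeta_upto :: "nat \<Rightarrow> nat \<Rightarrow> real" where
  "zeta_upto n k = (\<Sum>j=1..n. 1 / real j ^ k)"

text \<open>The polylogarithm on the real interval \<open>[-1, 1)\<close> (also at \<open>1\<close> if \<open>p \<ge> 2\<close>), summed from
  \<open>n = 1\<close>, hence the \<open>Suc\<close>. For \<open>p = 1\<close> the series still converges, conditionally at \<open>x = -1\<close>,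
  to \<open>- ln (1 - x)\<close>; so that case needs no separate clause.\<close>
definition Li :: "nat \<Rightarrow> real \<Rightarrow> real" where
  "Li p x = (\<Sum>n. x ^ Suc n / real (Suc n) ^ p)"

text \<open>The interval integral is oriented, so negative \<open>x\<close> gives minus the integral over \<open>[x, 0]\<close>.\<close>
definition Li_int :: "nat \<Rightarrow> nat \<Rightarrow> real \<Rightarrow> real" where
  "Li_int a b x = (LBINT t=ereal 0..ereal x. Li a t * Li b t / t)"

end

theory Submission
  imports Defs
begin

text \<open>
  Both sides vanish at \<open>0\<close> and are continuous on \<open>[-1, 1)\<close>, so it suffices to compare \<open>x d/dx\<close> of
  them on \<open>0 < |x| < 1\<close>. Put \<open>q = p + 2m + 1\<close> and let \<open>A\<^sub>J\<^sub>,\<^sub>e\<close> be the power series with coefficients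
  \<open>\<Sum>\<^sub>j \<zeta>\<^sub>n(j) / n\<^bsup>e - j\<^esup> + 2 H\<^sub>n / n\<^bsup>e - 1\<^esup>\<close>, \<open>2 \<le> j \<le> J\<close>. Since \<open>x d/dx\<close> lowers \<open>e\<close> and the order of the
  polylogarithms by one, each of the four alternating sums telescopes. The boundary terms
  containing \<open>Li\<^sub>1\<close> add up to the derivative of the left-hand side minus the logarithmic term; the other ones
  cancel against the integrands because of
  \<open>A\<^bsub>k - 1,k\<^esub> = k Li\<^sub>k + Li\<^sub>1 Li\<^bsub>k - 1\<^esub>\<close>, which follows by induction on \<open>k\<close>, again by differentiating.
\<close>

section \<open>Power series without constant term\<close>

definition ogf :: "(nat \<Rightarrow> real) \<Rightarrow> real \<Rightarrow> real" where
  "ogf f x = (\<Sum>n. f (Suc n) * x ^ Suc n)"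

text \<open>The exponent \<open>n\<close> instead of \<open>Suc n\<close> makes this a condition on
  \<open>ogf f x / x\<close>, which has to be controlled near \<open>0\<close> inside the integrals.
  Taking \<open>r = 1\<close> gives convergence up to the boundary, hence at
  \<open>x = -1\<close>.\<close>

definition abs_conv :: "real \<Rightarrow> (nat \<Rightarrow> real) \<Rightarrow> bool" where
  "abs_conv r f \<longleftrightarrow> summable (\<lambda>n. \<bar>f (Suc n)\<bar> * r ^ n)"

lemma abs_conv_mono:
  assumes "abs_conv r g" "0 \<le> r" "\<And>n. n \<ge> 1 \<Longrightarrow> \<bar>f n\<bar> \<le> g n"
  shows "abs_conv r f"
  unfolding abs_conv_def
proof (rule summable_comparison_test'[where N = 0])
  show "summable (\<lambda>n. \<bar>g (Suc n)\<bar> * r ^ n)" using assms(1) by (simp add: abs_conv_def)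
  fix n
  have "\<bar>f (Suc n)\<bar> \<le> \<bar>g (Suc n)\<bar>" using assms(3)[of "Suc n"] by simp
  then show "norm (\<bar>f (Suc n)\<bar> * r ^ n) \<le> \<bar>g (Suc n)\<bar> * r ^ n"
    using assms(2) by (simp add: abs_mult mult_right_mono)
qed

lemma abs_conv_add:
  assumes "abs_conv r f" "abs_conv r g" "0 \<le> r"
  shows "abs_conv r (\<lambda>n. f n + g n)"
proof (rule abs_conv_mono[where g = "\<lambda>n. \<bar>f n\<bar> + \<bar>g n\<bar>"])
  show "abs_conv r (\<lambda>n. \<bar>f n\<bar> + \<bar>g n\<bar>)"
    using summable_add[OF assms(1,2)[unfolded abs_conv_def]]
    by (simp add: abs_conv_def distrib_right)
qed (use assms in auto)

lemma abs_conv_cmult: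
  assumes "abs_conv r f" "0 \<le> r"
  shows "abs_conv r (\<lambda>n. c * f n)"
  using summable_mult[OF assms(1)[unfolded abs_conv_def], of "\<bar>c\<bar>"]
  by (simp add: abs_conv_def abs_mult mult.assoc)

lemma abs_conv_sum:
  assumes "finite I" "\<And>i. i \<in> I \<Longrightarrow> abs_conv r (f i)" "0 \<le> r"
  shows "abs_conv r (\<lambda>n. \<Sum>i\<in>I. f i n)"
  using assms
proof (induction I rule: finite_induct)
  case empty
  then show ?case by (simp add: abs_conv_def)
next
  case (insert i I)
  then show ?case by (simp add: abs_conv_add)
qed

text \<open>The majorant with coefficients \<open>n\<close> is the derivative of the geometric
  series; \<open>s\<close> supplies the larger radius that termwise differentiation asks
  for.\<close>

lemma abs_conv_le_self:
  assumes "\<And>n. n \<ge> 1 \<Longrightarrow> \<bar>f n\<bar> \<le> real n" "0 \<le> r" "r < 1"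
  shows "abs_conv r f"
proof (rule abs_conv_mono)
  obtain s where s: "r < s" "s < 1" using assms(3) dense by blast
  have "summable (\<lambda>n. diffs (\<lambda>n. 1) n * r ^ n)"
    by (rule termdiff_converges[where K = s]) (use s assms(2) in \<open>auto simp: summable_geometric\<close>)
  then show "abs_conv r real" by (simp add: abs_conv_def diffs_def)
qed (use assms in auto)

lemma abs_conv_shifted_summable:
  assumes "abs_conv r f" "\<bar>x\<bar> \<le> r"
  shows "summable (\<lambda>n. f (Suc n) * x ^ n)"
proof (rule summable_comparison_test'[where N = 0])
  show "summable (\<lambda>n. \<bar>f (Suc n)\<bar> * r ^ n)" using assms(1) by (simp add: abs_conv_def)
  show "norm (f (Suc n) * x ^ n) \<le> \<bar>f (Suc n)\<bar> * r ^ n" for n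
    using assms(2) by (simp add: abs_mult power_abs mult_left_mono power_mono)
qed

lemma abs_conv_summable:
  assumes "abs_conv r f" "\<bar>x\<bar> \<le> r"
  shows "summable (\<lambda>n. f (Suc n) * x ^ Suc n)"
  using summable_mult[OF abs_conv_shifted_summable[OF assms], of x]
  by (simp add: mult_ac)

lemma ogf_shift:
  assumes "abs_conv r f" "\<bar>x\<bar> \<le> r"
  shows "ogf f x = x * (\<Sum>n. f (Suc n) * x ^ n)"
  unfolding ogf_def suminf_mult[OF abs_conv_shifted_summable[OF assms], symmetric]
  by (simp add: mult_ac)

lemma ogf_add:
  assumes "abs_conv r f" "abs_conv r g" "\<bar>x\<bar> \<le> r"
  shows "ogf (\<lambda>n. f n + g n) x = ogf f x + ogf g x"
  using suminf_add[OF abs_conv_summable[OF assms(1,3)] abs_conv_summable[OF assms(2,3)]]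
  by (simp add: ogf_def distrib_right)

lemma ogf_cmult:
  assumes "abs_conv r f" "\<bar>x\<bar> \<le> r"
  shows "ogf (\<lambda>n. c * f n) x = c * ogf f x"
  using suminf_mult[OF abs_conv_summable[OF assms], of c]
  by (simp add: ogf_def mult.assoc)

lemma ogf_0 [simp]: "ogf f 0 = 0"
  by (simp add: ogf_def)

lemma ogf_cong:
  assumes "\<And>n. n \<ge> 1 \<Longrightarrow> f n = g n"
  shows "ogf f = ogf g"
  using assms by (simp add: ogf_def fun_eq_iff)

text \<open>By the M-test, continuity reaches the end points; with \<open>r = 1\<close> this
  replaces an Abel-type argument at \<open>-1\<close>.\<close>

lemma continuous_on_shifted_ogf:
  assumes "abs_conv r f"
  shows "continuous_on {-r..r} (\<lambda>x. \<Sum>n. f (Suc n) * x ^ n)"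
proof (rule uniform_limit_theorem)
  show "uniform_limit {-r..r} (\<lambda>N x. \<Sum>n<N. f (Suc n) * x ^ n)
          (\<lambda>x. \<Sum>n. f (Suc n) * x ^ n) sequentially"
  proof (rule Weierstrass_m_test)
    show "summable (\<lambda>n. \<bar>f (Suc n)\<bar> * r ^ n)" using assms by (simp add: abs_conv_def)
    show "norm (f (Suc n) * x ^ n) \<le> \<bar>f (Suc n)\<bar> * r ^ n" if "x \<in> {-r..r}" for n x
      using that by (auto simp: abs_mult power_abs intro!: mult_left_mono power_mono)
  qed
qed (auto intro!: continuous_intros always_eventually)

lemma continuous_on_ogf:
  assumes "abs_conv r f"
  shows "continuous_on {-r..r} (ogf f)"
proof -
  have "continuous_on {-r..r} (\<lambda>x. x * (\<Sum>n. f (Suc n) * x ^ n))"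
    by (intro continuous_intros continuous_on_shifted_ogf assms)
  then show ?thesis
    by (rule continuous_on_eq) (auto simp: ogf_shift[OF assms])
qed

lemma ogf_deriv:
  assumes f: "\<And>r. 0 \<le> r \<Longrightarrow> r < 1 \<Longrightarrow> abs_conv r f" and "\<bar>x\<bar> < 1" "x \<noteq> 0"
    and g: "\<And>n. n \<ge> 1 \<Longrightarrow> g n = real n * f n"
  shows "(ogf f has_real_derivative ogf g x / x) (at x)"
proof -
  \<comment> \<open>The constant coefficient is set to \<open>0\<close>, so that
    \<open>ogf f\<close> becomes a full power series and the library's termwise differentiation
    applies.\<close>
  define c where "c n = (if n = 0 then 0 else f n)" for n
  have sm: "summable (\<lambda>n. c n * y ^ n)" if "\<bar>y\<bar> < 1" for y
    by (subst summable_Suc_iff[symmetric])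
       (use abs_conv_summable[OF f, of "\<bar>y\<bar>" y] that in \<open>simp add: c_def\<close>)
  obtain s where s: "\<bar>x\<bar> < s" "s < 1" using assms(2) dense by blast
  have "ogf f y = (\<Sum>n. c n * y ^ n)" if "\<bar>y\<bar> < 1" for y
    using suminf_split_head[OF sm[OF that]] by (simp add: ogf_def c_def)
  moreover have "((\<lambda>x. \<Sum>n. c n * x ^ n) has_real_derivative (\<Sum>n. diffs c n * x ^ n)) (at x)"
    by (rule termdiffs_strong[where K = s]) (use s in \<open>auto intro: sm\<close>)
  moreover have "(\<Sum>n. diffs c n * x ^ n) = ogf g x / x"
  proof -
    have "summable (\<lambda>n. diffs c n * x ^ n)"
      by (rule termdiff_converges[where K = 1]) (use assms(2) sm in auto)
    from suminf_mult[OF this, of x] show ?thesis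
      using \<open>x \<noteq> 0\<close> by (simp add: ogf_def g diffs_def c_def field_simps)
  qed
  ultimately show ?thesis
    using has_field_derivative_transform_within_open[of _ _ x "{-1<..<1}" "ogf f"] assms(2)
    by (auto simp: abs_less_iff)
qed

text \<open>Derivatives are required only strictly between \<open>0\<close> and \<open>x\<close>.
  This avoids \<open>0\<close>, where quotients by \<open>t\<close> have a junk value, and the end
  point \<open>-1\<close>, where only continuity is at hand.\<close>

lemma eq_zero_of_deriv_zero:
  fixes f :: "real \<Rightarrow> real"
  assumes "f 0 = 0" and "continuous_on (closed_segment 0 x) f"
    and "\<And>t. t \<in> open_segment 0 x \<Longrightarrow> (f has_real_derivative 0) (at t)"
  shows "f x = 0"
proof (cases x "0 :: real" rule: linorder_cases)
  case less
  then show ?thesis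
    using DERIV_isconst_end[of x 0 f] assms
    by (simp add: closed_segment_eq_real_ivl open_segment_eq_real_ivl)
next
  case greater
  then show ?thesis
    using DERIV_isconst_end[of 0 x f] assms
    by (simp add: closed_segment_eq_real_ivl open_segment_eq_real_ivl)
qed (use assms in simp)

subsection \<open>Coefficient bounds\<close>

lemma zeta_upto_nonneg: "zeta_upto n k \<ge> 0"
  by (simp add: zeta_upto_def sum_nonneg)

lemma zeta_upto_1: "zeta_upto n 1 = harm n"
  by (simp add: zeta_upto_def harm_def divide_inverse)

lemma zeta_upto_Suc: "zeta_upto (Suc n) k = zeta_upto n k + 1 / real (Suc n) ^ k"
  by (simp add: zeta_upto_def)

lemma zeta_upto_le_self: "zeta_upto n k \<le> real n"
proof -
  have "zeta_upto n k \<le> (\<Sum>j=1..n. 1)"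
    unfolding zeta_upto_def by (rule sum_mono) (auto simp: divide_le_eq)
  then show ?thesis by simp
qed

lemma zeta_upto_le_harm:
  assumes "k \<ge> 1" shows "zeta_upto n k \<le> harm n"
  unfolding zeta_upto_1[symmetric] zeta_upto_def
  using assms by (intro sum_mono divide_left_mono) (auto intro: self_le_power)

text \<open>A crude growth bound that still makes \<open>harm n / n^2\<close> summable. The
  increment is handled by \<open>1 / s^2 \<le> 1 / s \<le> 2 * (s - t)\<close>, where
  \<open>s^2 - t^2 = 1\<close>.\<close>

lemma harm_le_sqrt: "harm n \<le> 2 * sqrt (real n)"
proof (induction n)
  case (Suc n)
  define s t where "s = sqrt (real (Suc n))" and "t = sqrt (real n)"
  have st: "s\<^sup>2 = t\<^sup>2 + 1" "s\<^sup>2 = real (Suc n)" "s \<ge> 1" by (simp_all add: s_def t_def)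
  have "0 \<le> (s - t)\<^sup>2" by simp
  then have "1 \<le> (2 * s - 2 * t) * s" using st(1) by (simp add: power2_eq_square algebra_simps)
  then have "1 / s \<le> 2 * s - 2 * t" using st(3) by (simp add: divide_le_eq)
  moreover have "1 / s\<^sup>2 \<le> 1 / s" using st(3) by (simp add: power2_eq_square field_simps)
  ultimately have "1 / real (Suc n) \<le> 2 * sqrt (real (Suc n)) - 2 * sqrt (real n)"
    using st(2) by (simp add: s_def t_def)
  then show ?case using Suc by (simp add: harm_Suc divide_inverse)
qed (simp add: harm_def)

lemma abs_conv_zeta_coeff:
  assumes "0 \<le> r" "r < 1"
  shows "abs_conv r (\<lambda>n. zeta_upto n a / real n ^ b)"
proof (rule abs_conv_le_self)
  fix n :: nat assume "n \<ge> 1"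
  then have "zeta_upto n a / real n ^ b \<le> zeta_upto n a"
    using divide_left_mono[of 1 "real n ^ b" "zeta_upto n a"] by (simp add: zeta_upto_nonneg)
  then show "\<bar>zeta_upto n a / real n ^ b\<bar> \<le> real n"
    using zeta_upto_le_self[of n a] by (simp add: zeta_upto_nonneg abs_of_nonneg)
qed (use assms in auto)

text \<open>The numerator is at most \<open>harm n\<close>, thus of order \<open>sqrt n\<close>, and
  dividing by \<open>n^2\<close> leaves the convergent majorant
  \<open>2 * n powr (-3/2)\<close>.\<close>

lemma abs_conv_1_zeta_coeff:
  assumes "a \<ge> 1" "b \<ge> 2"
  shows "abs_conv 1 (\<lambda>n. zeta_upto n a / real n ^ b)"
proof (rule abs_conv_mono)
  have "summable (\<lambda>n. real n powr (-3/2))" by (subst summable_real_powr_iff) simp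
  then have "summable (\<lambda>n. 2 * real (Suc n) powr (-3/2))"
    using summable_Suc_iff[of "\<lambda>n. real n powr (-3/2)"] by (intro summable_mult) blast
  then show "abs_conv 1 (\<lambda>n. 2 * real n powr (-3/2))" by (simp add: abs_conv_def)
  fix n :: nat assume n: "n \<ge> 1"
  have "zeta_upto n a / real n ^ b \<le> 2 * sqrt (real n) / real n ^ 2"
    using zeta_upto_le_harm[OF assms(1), of n] harm_le_sqrt[of n] n assms(2)
    by (intro frac_le) (auto simp: power_increasing)
  also have "\<dots> = 2 * real n powr (-3/2)"
  proof -
    have "sqrt (real n) / real n ^ 2 = real n powr (1/2) / real n powr 2"
      using n by (simp add: powr_half_sqrt)
    also have "\<dots> = real n powr (-3/2)" by (subst powr_diff[symmetric]) simp
    finally show ?thesis by simp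
  qed
  finally show "\<bar>zeta_upto n a / real n ^ b\<bar> \<le> 2 * real n powr (-3/2)"
    by (simp add: zeta_upto_nonneg abs_of_nonneg)
qed auto


lemma abs_conv_inverse_power:
  assumes "0 \<le> r" "r < 1"
  shows "abs_conv r (\<lambda>n. 1 / real n ^ s)"
proof (rule abs_conv_le_self)
  fix n :: nat assume "n \<ge> 1"
  then have "1 / real n ^ s \<le> 1" by (simp add: divide_le_eq)
  also have "1 \<le> real n" using \<open>n \<ge> 1\<close> by simp
  finally show "\<bar>1 / real n ^ s\<bar> \<le> real n" by simp
qed (use assms in auto)

lemma abs_conv_1_inverse_power:
  assumes "s \<ge> 2"
  shows "abs_conv 1 (\<lambda>n. 1 / real n ^ s)"
proof (rule abs_conv_mono)
  show "abs_conv 1 (\<lambda>n. zeta_upto n 1 / real n ^ s)" by (rule abs_conv_1_zeta_coeff) (use assms in auto)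
  fix n :: nat assume "n \<ge> 1"
  then have "1 \<le> zeta_upto n 1"
    using sum_mono2[of "{1..n}" "{1}" "\<lambda>j. 1 / real j ^ 1"] by (simp add: zeta_upto_def)
  then show "\<bar>1 / real n ^ s\<bar> \<le> zeta_upto n 1 / real n ^ s" by (simp add: divide_right_mono)
qed auto

subsection \<open>Polylogarithms\<close>

lemma Li_ogf: "Li s x = ogf (\<lambda>n. 1 / real n ^ s) x"
  by (simp add: Li_def ogf_def)

lemma Li_at_0 [simp]: "Li s 0 = 0"
  by (simp add: Li_ogf)

lemma Li_deriv:
  assumes "\<bar>x\<bar> < 1" "x \<noteq> 0" "s \<ge> 1"
  shows "(Li s has_real_derivative Li (s - 1) x / x) (at x)"
  unfolding Li_ogf[abs_def]
  by (rule ogf_deriv) (use assms in \<open>auto intro: abs_conv_inverse_power simp: power_diff\<close>)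

lemma Li_0:
  assumes "\<bar>x\<bar> < 1"
  shows "Li 0 x = x / (1 - x)"
  using assms suminf_mult[OF summable_geometric[of x], of x] suminf_geometric[of x]
  by (simp add: Li_def)

text \<open>Since \<open>1 / (1 - x) = 1 + Li 0 x\<close>, this turns denominators into
  polylogarithms, after which the derivative identities are purely algebraic.\<close>

lemma Li_0_geometric:
  assumes "\<bar>x\<bar> < 1"
  shows "y / (1 - x) = y + y * Li 0 x"
  using assms by (simp add: Li_0 field_simps)

lemma Li_1:
  assumes "x \<in> {-1..<1}"
  shows "Li 1 x = - ln (1 - x)"
proof (cases "x = -1")
  case True
  then show ?thesis
    using sums_minus[OF alternating_harmonic_series_sums] by (auto simp: Li_def sums_iff)
next
  case False
  \<comment> \<open>The logarithm series is available for \<open>0 < 1 - x < 2\<close>, so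
    \<open>x = -1\<close> had to be treated apart.\<close>
  then have "ln (1 - x) = (\<Sum>n. (-1) ^ n * (1 / real (n + 1)) * ((1 - x) - 1) ^ Suc n)"
    using assms by (intro ln_series) auto
  also have "\<dots> = (\<Sum>n. - (x ^ Suc n / real (Suc n) ^ 1))"
    by (intro suminf_cong) (simp add: power_minus[of x])
  also have "\<dots> = - Li 1 x"
    unfolding Li_def using False assms abs_conv_summable[OF abs_conv_inverse_power[of "\<bar>x\<bar>" 1], of x]
    by (intro suminf_minus) auto
  finally show ?thesis by simp
qed

text \<open>For \<open>s = 1\<close> the series is not absolutely convergent at \<open>-1\<close>,
  so continuity comes from the logarithm; for larger \<open>s\<close> the M-test suffices.\<close>

lemma continuous_on_Li:
  assumes "s \<ge> 1"
  shows "continuous_on {-1..<1} (Li s)"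
proof (cases "s = 1")
  case True
  have "continuous_on {-1..<1} (\<lambda>x :: real. - ln (1 - x))" by (intro continuous_intros) auto
  then show ?thesis unfolding True by (rule continuous_on_eq) (simp add: Li_1[symmetric])
next
  case False
  then have "continuous_on {-1..1} (ogf (\<lambda>n. 1 / real n ^ s))"
    by (intro continuous_on_ogf abs_conv_1_inverse_power) (use assms in auto)
  then show ?thesis unfolding Li_ogf[abs_def] by (rule continuous_on_subset) auto
qed

text \<open>Fundamental theorem of calculus on a compact interval; \<open>c < 1\<close> keeps away
  from the singularity of \<open>Li 1\<close> at \<open>1\<close>, and the derivative within the
  interval also covers the end point \<open>-1\<close>.\<close>

lemma Li_int_deriv:
  assumes "a \<ge> 1" "b \<ge> 2" "c < 1" "-1 \<le> x" "x \<le> c" "0 \<le> c"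
  shows "(Li_int a b has_real_derivative Li a x * Li b x / x) (at x within {-1..c})"
proof -
  \<comment> \<open>\<open>h t = Li b t / t\<close> extended continuously to \<open>0\<close>, where the quotient has the junk value \<open>0\<close>;
    the integrand is not affected, since \<open>Li a 0 = 0\<close>.\<close>
  define h where "h x = (\<Sum>n. 1 / real (Suc n) ^ b * x ^ n)" for x :: real
  have h: "Li a t * Li b t / t = Li a t * h t" if "\<bar>t\<bar> \<le> 1" for t
    using ogf_shift[OF abs_conv_1_inverse_power[OF assms(2)] that]
    by (cases "t = 0") (simp_all add: Li_ogf[of b] h_def)
  have "continuous_on {-1..1} h"
    using continuous_on_shifted_ogf[OF abs_conv_1_inverse_power[OF assms(2)]] by (simp add: h_def[abs_def])
  then have "continuous_on {-1..c} (\<lambda>t. Li a t * h t)"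
    using assms by (intro continuous_intros continuous_on_subset[OF continuous_on_Li[OF assms(1)]])
      (auto elim: continuous_on_subset)
  from interval_integral_FTC2[OF _ _ this, of 0 x] assms
  have "((\<lambda>u. LBINT y=ereal 0..ereal u. Li a y * h y) has_real_derivative Li a x * h x) (at x within {-1..c})"
    by (simp add: has_real_derivative_iff_has_vector_derivative)
  moreover have "Li_int a b u = (LBINT y=ereal 0..ereal u. Li a y * h y)" if "u \<in> {-1..c}" for u
    unfolding Li_int_def
    by (rule interval_integral_cong)
       (use that assms in \<open>auto simp: einterval_iff min_def max_def intro!: h split: if_splits\<close>)
  ultimately show ?thesis
    using assms h[of x]
    by (auto intro!: has_field_derivative_transform_within[where d = 1 and f = "\<lambda>u. LBINT y=ereal 0..ereal u. Li a y * h y"])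
qed

lemma Li_int_0 [simp]: "Li_int a b 0 = 0"
  by (simp add: Li_int_def zero_ereal_def[symmetric])

subsection \<open>Generating functions of harmonic numbers\<close>

text \<open>The harmonic term is twice the summand that \<open>j = 1\<close> would give, so all
  terms have weight \<open>e\<close>. The four inner series of the theorem have
  \<open>(J, e)\<close> equal to \<open>(p - 1, p + i)\<close>, \<open>(p, p + 1 + i)\<close>,
  \<open>(p + 2*m + 1, p + 2*m + 2 + i)\<close> and
  \<open>(p + 2*m, p + 2*m + 1 + i)\<close>.\<close>

definition euler_coeff :: "nat \<Rightarrow> nat \<Rightarrow> nat \<Rightarrow> real" where
  "euler_coeff J e n =
     (\<Sum>j=2..J. zeta_upto n j / real n ^ (e - j)) + 2 * (harm n / real n ^ (e - 1))"

definition euler_ser :: "nat \<Rightarrow> nat \<Rightarrow> real \<Rightarrow> real" where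
  "euler_ser J e = ogf (euler_coeff J e)"

lemma abs_conv_euler_coeff:
  assumes "0 \<le> r" "r < 1"
  shows "abs_conv r (euler_coeff J e)"
  unfolding euler_coeff_def[abs_def] zeta_upto_1[symmetric]
  using assms by (intro abs_conv_add abs_conv_sum abs_conv_cmult abs_conv_zeta_coeff) auto

lemma abs_conv_1_euler_coeff:
  assumes "J + 2 \<le> e" "3 \<le> e"
  shows "abs_conv 1 (euler_coeff J e)"
  unfolding euler_coeff_def[abs_def] zeta_upto_1[symmetric]
  using assms by (intro abs_conv_add abs_conv_sum abs_conv_cmult abs_conv_1_zeta_coeff) auto

lemma euler_ser_0 [simp]: "euler_ser J e 0 = 0"
  by (simp add: euler_ser_def)

text \<open>The operator \<open>x d/dx\<close> multiplies the \<open>n\<close>-th coefficient by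
  \<open>n\<close>. The bound \<open>J \<le> e\<close> keeps the truncated differences
  \<open>e - j\<close> genuine.\<close>

lemma euler_ser_deriv:
  assumes "\<bar>x\<bar> < 1" "x \<noteq> 0" "J \<le> e" "1 \<le> e"
  shows "(euler_ser J (Suc e) has_real_derivative euler_ser J e x / x) (at x)"
  unfolding euler_ser_def
proof (rule ogf_deriv)
  fix n :: nat assume "n \<ge> 1"
  have "real n * (zeta_upto n j / real n ^ (Suc e - j)) = zeta_upto n j / real n ^ (e - j)" if "j \<in> {2..J}" for j
    using \<open>n \<ge> 1\<close> assms that by (simp add: Suc_diff_le)
  moreover have "real n * (2 * (harm n / real n ^ (Suc e - 1))) = 2 * (harm n / real n ^ (e - 1))"
    using \<open>n \<ge> 1\<close> assms by (simp add: power_diff)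
  ultimately show "euler_coeff J e n = real n * euler_coeff J (Suc e) n"
    unfolding euler_coeff_def distrib_left sum_distrib_left by (metis (no_types, lifting) sum.cong)
qed (use assms in \<open>auto intro: abs_conv_euler_coeff\<close>)

text \<open>Multiplication by \<open>1 - x\<close> takes differences of consecutive coefficients,
  and these are \<open>1 / n^a\<close>. As \<open>zeta_upto 0 a = 0\<close>, the series may be
  started at \<open>0\<close> for the index shift.\<close>

lemma ogf_zeta_upto:
  assumes "\<bar>x\<bar> < 1"
  shows "ogf (\<lambda>n. zeta_upto n a) x = Li a x / (1 - x)"
proof -
  have ac: "abs_conv \<bar>x\<bar> (\<lambda>n. zeta_upto n a)"
    using abs_conv_zeta_coeff[of "\<bar>x\<bar>" a 0] assms by simp
  have s: "summable (\<lambda>n. zeta_upto (Suc n) a * x ^ Suc n)" by (rule abs_conv_summable[OF ac]) simp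
  then have s0: "summable (\<lambda>n. zeta_upto n a * x ^ n)" by (subst (asm) summable_Suc_iff)
  then have s1: "summable (\<lambda>n. x * (zeta_upto n a * x ^ n))" by (rule summable_mult)
  have "ogf (\<lambda>n. zeta_upto n a) x = (\<Sum>n. zeta_upto n a * x ^ n)"
    using suminf_split_head[OF s0] by (simp add: ogf_def zeta_upto_def)
  then have "ogf (\<lambda>n. zeta_upto n a) x - x * ogf (\<lambda>n. zeta_upto n a) x
      = (\<Sum>n. zeta_upto (Suc n) a * x ^ Suc n) - (\<Sum>n. x * (zeta_upto n a * x ^ n))"
    using suminf_mult[OF s0, of x] by (simp add: ogf_def)
  also have "\<dots> = (\<Sum>n. zeta_upto (Suc n) a * x ^ Suc n - x * (zeta_upto n a * x ^ n))"
    by (rule suminf_diff[OF s s1])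
  also have "\<dots> = Li a x"
    unfolding Li_def by (intro suminf_cong) (simp add: zeta_upto_Suc algebra_simps)
  finally show ?thesis using assms by (simp add: field_simps)
qed

lemma euler_ser_step:
  assumes "\<bar>x\<bar> < 1" "J \<ge> 2"
  shows "euler_ser J e x = euler_ser (J - 1) e x + ogf (\<lambda>n. zeta_upto n J / real n ^ (e - J)) x"
proof -
  have "euler_coeff J e n = euler_coeff (J - 1) e n + zeta_upto n J / real n ^ (e - J)" for n
  proof -
    have "{2..J} = insert J {2..J - 1}" using assms by auto
    then show ?thesis using assms by (simp add: euler_coeff_def)
  qed
  then have "euler_ser J e x = ogf (\<lambda>n. euler_coeff (J - 1) e n + zeta_upto n J / real n ^ (e - J)) x"
    unfolding euler_ser_def by (simp only: ogf_def)
  also have "\<dots> = euler_ser (J - 1) e x + ogf (\<lambda>n. zeta_upto n J / real n ^ (e - J)) x"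
    unfolding euler_ser_def using assms
    by (intro ogf_add[where r = "\<bar>x\<bar>"] abs_conv_euler_coeff abs_conv_zeta_coeff) auto
  finally show ?thesis .
qed

text \<open>For \<open>J = e\<close> the last summand has denominator \<open>n^0\<close>, so it is a
  bare partial zeta sum with a closed generating function.\<close>

lemma euler_ser_diag:
  assumes "\<bar>x\<bar> < 1" "k \<ge> 2"
  shows "euler_ser k k x = euler_ser (k - 1) k x + Li k x / (1 - x)"
  using euler_ser_step[OF assms, of k] assms by (simp add: ogf_zeta_upto)

lemma euler_ser_1_1:
  assumes "\<bar>x\<bar> < 1"
  shows "euler_ser 1 1 x = 2 * (Li 1 x / (1 - x))"
proof -
  have "euler_ser 1 1 x = ogf (\<lambda>n. 2 * zeta_upto n 1) x"
    using zeta_upto_1 by (simp add: euler_ser_def euler_coeff_def ogf_def)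
  also have "\<dots> = 2 * ogf (\<lambda>n. zeta_upto n 1) x"
    using assms abs_conv_zeta_coeff[of "\<bar>x\<bar>" 1 0]
    by (intro ogf_cmult[where r = "\<bar>x\<bar>"]) auto
  finally show ?thesis using assms by (simp add: ogf_zeta_upto)
qed

lemma euler_ser_eval:
  assumes "k \<ge> 2" "\<bar>x\<bar> < 1"
  shows "euler_ser (k - 1) k x = real k * Li k x + Li 1 x * Li (k - 1) x"
proof -
  \<comment> \<open>The point \<open>x\<close> is generalised, since the induction hypothesis is
    used at every \<open>t\<close> between \<open>0\<close> and \<open>x\<close>.\<close>
  have "real k * Li k x - euler_ser (k - 1) k x + Li 1 x * Li (k - 1) x = 0"
    using assms
  proof (induction k arbitrary: x rule: dec_induct)
    case base
    let ?f = "\<lambda>x. 2 * Li 2 x - euler_ser 1 2 x + Li 1 x * Li 1 x"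
    have "?f x = 0"
    proof (rule eq_zero_of_deriv_zero[of ?f])
      show "continuous_on (closed_segment 0 x) ?f"
        using base unfolding euler_ser_def
        by (intro continuous_intros continuous_on_subset[OF continuous_on_Li]
              continuous_on_subset[OF continuous_on_ogf[OF abs_conv_euler_coeff[of "\<bar>x\<bar>"]]])
           (auto simp: closed_segment_eq_real_ivl split: if_splits)
      fix t assume "t \<in> open_segment 0 x"
      then have t: "\<bar>t\<bar> < 1" "t \<noteq> 0" using base by (auto simp: open_segment_eq_real_ivl split: if_splits)
      have "(?f has_real_derivative 2 * (Li 1 t / t) - euler_ser 1 1 t / t
               + (Li 1 t * (Li 0 t / t) + (Li 0 t / t) * Li 1 t)) (at t)"
        using Li_deriv[OF t, of 2] Li_deriv[OF t, of 1] euler_ser_deriv[OF t, of 1 1]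
        by (auto intro!: derivative_eq_intros simp: numeral_2_eq_2)
      also have "2 * (Li 1 t / t) - euler_ser 1 1 t / t
               + (Li 1 t * (Li 0 t / t) + (Li 0 t / t) * Li 1 t) = 0"
        unfolding euler_ser_1_1[OF t(1)] Li_0_geometric[OF t(1)]
        by (simp add: algebra_simps add_divide_distrib)
      finally show "(?f has_real_derivative 0) (at t)" .
    qed simp
    then show ?case by simp
  next
    case (step k)
    let ?f = "\<lambda>x. real (Suc k) * Li (Suc k) x - euler_ser k (Suc k) x + Li 1 x * Li k x"
    have "?f x = 0"
    proof (rule eq_zero_of_deriv_zero[of ?f])
      show "continuous_on (closed_segment 0 x) ?f"
        using step.hyps step.prems unfolding euler_ser_def
        by (intro continuous_intros continuous_on_subset[OF continuous_on_Li]
              continuous_on_subset[OF continuous_on_ogf[OF abs_conv_euler_coeff[of "\<bar>x\<bar>"]]])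
           (auto simp: closed_segment_eq_real_ivl split: if_splits)
      fix t assume "t \<in> open_segment 0 x"
      then have t: "\<bar>t\<bar> < 1" "t \<noteq> 0"
        using step.prems by (auto simp: open_segment_eq_real_ivl split: if_splits)
      have "(?f has_real_derivative real (Suc k) * (Li k t / t) - euler_ser k k t / t
               + (Li 1 t * (Li (k - 1) t / t) + (Li 0 t / t) * Li k t)) (at t)"
        using Li_deriv[OF t, of "Suc k"] Li_deriv[OF t, of k] Li_deriv[OF t, of 1]
          euler_ser_deriv[OF t, of k k] step(1)
        by (auto intro!: derivative_eq_intros simp: mult.commute)
      \<comment> \<open>Splitting off the diagonal term subtracts
        \<open>Li k t + Li k t * Li 0 t\<close>: the first part lowers the factor
        \<open>k + 1\<close> to \<open>k\<close>, the second cancels the derivative of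
        \<open>Li 1\<close>. What remains is the identity for \<open>k\<close>.\<close>
      also have "real (Suc k) * (Li k t / t) - euler_ser k k t / t
               + (Li 1 t * (Li (k - 1) t / t) + (Li 0 t / t) * Li k t)
          = (real k * Li k t - euler_ser (k - 1) k t + Li 1 t * Li (k - 1) t) / t"
        unfolding euler_ser_diag[OF t(1) step(1)] Li_0_geometric[OF t(1)]
        by (simp add: algebra_simps add_divide_distrib diff_divide_distrib)
      also have "\<dots> = 0" using step.IH[OF t(1)] by simp
      finally show "(?f has_real_derivative 0) (at t)" .
    qed simp
    then show ?case by simp
  qed
  then show ?thesis by simp
qed

section \<open>Telescoping alternating sums\<close>

text \<open>In the product rule, differentiating the polylogarithm in summand \<open>i\<close> gives
  the negative of differentiating the series in summand \<open>i + 1\<close>, so only the two ends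
  survive.\<close>

lemma telescoping_deriv:
  assumes "\<bar>t\<bar> < 1" "t \<noteq> 0" "J \<le> e" "1 \<le> e" "K \<le> s"
  shows "((\<lambda>x. \<Sum>i=1..K. (-1) ^ (i - 1) * Li (s + 1 - i) x * euler_ser J (e + i) x)
     has_real_derivative (Li s t * euler_ser J e t - (-1) ^ K * Li (s - K) t * euler_ser J (e + K) t) / t) (at t)"
  using assms(5)
proof (induction K)
  case (Suc K)
  have "(Li (s - K) has_real_derivative Li (s - Suc K) t / t) (at t)"
    using Li_deriv[OF assms(1,2), of "s - K"] Suc by simp
  moreover have "(euler_ser J (Suc (e + K)) has_real_derivative euler_ser J (e + K) t / t) (at t)"
    using euler_ser_deriv[OF assms(1,2), of J "e + K"] assms by simp
  ultimately have "((\<lambda>x. (-1) ^ K * (Li (s - K) x * euler_ser J (Suc (e + K)) x)) has_real_derivative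
      (-1) ^ K * (Li (s - K) t * (euler_ser J (e + K) t / t) + Li (s - Suc K) t / t * euler_ser J (Suc (e + K)) t)) (at t)"
    by (intro DERIV_cmult DERIV_mult')
  from DERIV_add[OF Suc.IH this] Suc.prems show ?case
    by (simp add: Suc_diff_Suc algebra_simps add_divide_distrib diff_divide_distrib)
qed simp

text \<open>As \<open>i \<ge> 1\<close>, every exponent in the coefficients is at least
  \<open>2\<close>, which gives absolute convergence at \<open>-1\<close>; and
  \<open>K \<le> s\<close> keeps the polylogarithms at order at least \<open>1\<close>.\<close>

lemma continuous_on_telescoping:
  assumes "J + 1 \<le> e" "2 \<le> e" "K \<le> s"
  shows "continuous_on {-1..<1} (\<lambda>x. \<Sum>i=1..K. (-1) ^ (i - 1) * Li (s + 1 - i) x * euler_ser J (e + i) x)"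
proof (intro continuous_intros)
  fix i assume i: "i \<in> {1..K}"
  show "continuous_on {-1..<1} (Li (s + 1 - i))"
    by (rule continuous_on_Li) (use i assms in auto)
  have "continuous_on {-1..1} (euler_ser J (e + i))"
    unfolding euler_ser_def by (intro continuous_on_ogf abs_conv_1_euler_coeff) (use i assms in auto)
  then show "continuous_on {-1..<1} (euler_ser J (e + i))"
    by (rule continuous_on_subset) auto
qed

subsection \<open>Both sides have the same derivative\<close>

lemma sum_zero_power_divide: "(\<Sum>k=1..n. 0 ^ k / real k) = (0 :: real)"
  by (rule sum.neutral) auto

text \<open>Each inner sum differentiates to the geometric sum \<open>(1 - x^n) / (1 - x)\<close>.
  Bounding it by \<open>2 / (1 - b)\<close> makes the differentiated series uniformly convergent,
  which is the purpose of \<open>b < 1\<close>.\<close>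

lemma partial_log_series_deriv:
  assumes c: "abs_conv 1 c" and "0 \<le> b" "b < 1" and x: "x \<in> {-1..b}"
  shows "((\<lambda>x. \<Sum>n. c (Suc n) * (\<Sum>k=1..Suc n. x ^ k / real k))
     has_real_derivative (ogf c 1 - ogf c x) / (1 - x)) (at x within {-1..b})"
proof -
  define f where "f n y = c (Suc n) * (\<Sum>k=1..Suc n. y ^ k / real k)" for n and y :: real
  define f' where "f' n y = c (Suc n) * ((1 - y ^ Suc n) / (1 - y))" for n and y :: real
  have "(f n has_real_derivative f' n y) (at y within {-1..b})" if "y \<in> {-1..b}" for n y
  proof -
    have "((\<lambda>y. \<Sum>k=1..Suc n. y ^ k / real k) has_real_derivative (\<Sum>k=1..Suc n. y ^ (k - 1))) (at y within {-1..b})"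
    proof (rule DERIV_sum)
      fix k assume "k \<in> {1..Suc n}"
      then show "((\<lambda>y. y ^ k / real k) has_real_derivative y ^ (k - 1)) (at y within {-1..b})"
        using DERIV_cdivide[OF DERIV_pow[of k y "{-1..b}"], of "real k"] by simp
    qed
    moreover have "(\<Sum>k=1..Suc n. y ^ (k - 1)) = (1 - y ^ Suc n) / (1 - y)"
      using that assms sum_gp_strict[of y "Suc n"]
      by (simp add: sum.atLeast1_atMost_eq)
    ultimately show ?thesis
      unfolding f_def[abs_def] f'_def by (intro DERIV_cmult) simp
  qed
  moreover have "uniform_limit {-1..b} (\<lambda>n y. \<Sum>i<n. f' i y) (\<lambda>y. \<Sum>i. f' i y) sequentially"
  proof (rule Weierstrass_m_test)
    show "summable (\<lambda>n. \<bar>c (Suc n)\<bar> * (2 / (1 - b)))"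
      using c by (intro summable_mult2) (simp add: abs_conv_def)
    fix n y assume y: "y \<in> {-1..b}"
    then have "\<bar>y\<bar> ^ Suc n \<le> 1" using assms by (intro power_le_one) auto
    then have "\<bar>1 - y ^ Suc n\<bar> \<le> 2" unfolding power_abs[symmetric] by linarith
    then have "\<bar>1 - y ^ Suc n\<bar> / (1 - y) \<le> 2 / (1 - b)"
      using y assms by (intro frac_le) auto
    then show "norm (f' n y) \<le> \<bar>c (Suc n)\<bar> * (2 / (1 - b))"
      using y assms mult_left_mono[of "\<bar>1 - y ^ Suc n\<bar> / (1 - y)" "2 / (1 - b)" "\<bar>c (Suc n)\<bar>"]
      by (simp add: f'_def abs_mult)
  qed
  \<comment> \<open>Termwise differentiation also needs convergence at one point; at
    \<open>0\<close> all terms vanish.\<close>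
  moreover have "summable (\<lambda>n. f n 0)" unfolding f_def sum_zero_power_divide by simp
  ultimately have "\<exists>g. \<forall>y\<in>{-1..b}. (\<lambda>n. f n y) sums g y \<and>
         (g has_real_derivative (\<Sum>i. f' i y)) (at y within {-1..b})"
    using assms by (intro has_field_derivative_series) auto
  then obtain g where
    g: "\<And>y. y \<in> {-1..b} \<Longrightarrow> (\<lambda>n. f n y) sums g y \<and>
         (g has_real_derivative (\<Sum>i. f' i y)) (at y within {-1..b})"
    by blast
  have "((\<lambda>y. \<Sum>n. f n y) has_real_derivative (\<Sum>i. f' i x)) (at x within {-1..b})"
    using g[THEN conjunct1, THEN sums_unique] g[OF x] x
    by (auto intro: has_field_derivative_transform_within[where d = 1 and f = g])
  moreover have "(\<Sum>i. f' i x) = (ogf c 1 - ogf c x) / (1 - x)"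
  proof -
    have s: "summable (\<lambda>n. c (Suc n) * 1 ^ Suc n)" "summable (\<lambda>n. c (Suc n) * x ^ Suc n)"
      by (rule abs_conv_summable[OF c]; use x assms in auto)+
    have "f' i x = (c (Suc i) * 1 ^ Suc i - c (Suc i) * x ^ Suc i) / (1 - x)" for i
      by (simp add: f'_def algebra_simps)
    then show ?thesis
      unfolding ogf_def suminf_diff[OF s] using suminf_divide[OF summable_diff[OF s], of "1 - x"] by simp
  qed
  ultimately show ?thesis by (simp add: f_def[abs_def])
qed

theorem theorem2p5:
  fixes p m :: nat and x :: real
  assumes "p \<ge> 2" and "x \<in> {-1..<1}"
  shows
    "(-1) ^ p * (\<Sum>n. (zeta_upto (Suc n) (p + 2*m + 1) / real (Suc n) ^ p
                       + zeta_upto (Suc n) p / real (Suc n) ^ (p + 2*m + 1))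
                     * (\<Sum>k=1..Suc n. x ^ k / real k))
     = real (p + 2*m + 2) * Li_int (p - 1) (p + 2*m + 2) x
       + real (2*m + 1) * Li_int p (p + 2*m + 1) x
       - real (p + 1) * Li_int (p + 1) (p + 2*m) x
       + (-1) ^ p * ln (1 - x)
           * (\<Sum>n. (zeta_upto (Suc n) (p + 2*m + 1) / real (Suc n) ^ p
                    + zeta_upto (Suc n) p / real (Suc n) ^ (p + 2*m + 1))
                  * (x ^ Suc n - 1))
       + (\<Sum>i=1..p + 2*m. (-1) ^ (i - 1) * Li (p + 2*m + 2 - i) x
           * (\<Sum>n. ((\<Sum>j=2..p - 1. zeta_upto (Suc n) j / real (Suc n) ^ (p + i - j))
                    + 2 * (harm (Suc n) / real (Suc n) ^ (p + i - 1))) * x ^ Suc n))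
       + (\<Sum>i=1..p + 2*m - 1. (-1) ^ (i - 1) * Li (p + 2*m + 1 - i) x
           * (\<Sum>n. ((\<Sum>j=2..p. zeta_upto (Suc n) j / real (Suc n) ^ (p + 1 + i - j))
                    + 2 * (harm (Suc n) / real (Suc n) ^ (p + i))) * x ^ Suc n))
       - (\<Sum>i=1..p - 2. (-1) ^ (i - 1) * Li (p - i) x
           * (\<Sum>n. ((\<Sum>j=2..p + 2*m + 1. zeta_upto (Suc n) j / real (Suc n) ^ (p + 2*m + 2 + i - j))
                    + 2 * (harm (Suc n) / real (Suc n) ^ (p + 2*m + 1 + i))) * x ^ Suc n))
       - (\<Sum>i=1..p - 1. (-1) ^ (i - 1) * Li (p + 1 - i) x
           * (\<Sum>n. ((\<Sum>j=2..p + 2*m. zeta_upto (Suc n) j / real (Suc n) ^ (p + 2*m + 1 + i - j))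
                    + 2 * (harm (Suc n) / real (Suc n) ^ (p + 2*m + i))) * x ^ Suc n))"
proof -
  define c where "c n = zeta_upto n (p + 2*m + 1) / real n ^ p + zeta_upto n p / real n ^ (p + 2*m + 1)" for n
  define F where "F y = (\<Sum>n. c (Suc n) * (\<Sum>k=1..Suc n. y ^ k / real k))" for y :: real
  define T where "T J e K s y = (\<Sum>i=1..K. (-1) ^ (i - 1) * Li (s + 1 - i) y * euler_ser J (e + i) y)"
    for J e K s and y :: real
  \<comment> \<open>Left-hand side minus right-hand side. In each \<open>T\<close> the length is
    \<open>K = s - 1\<close>, so the telescoping ends at \<open>Li 1\<close>.\<close>
  define D where "D y = (-1) ^ p * F y
      - (real (p + 2*m + 2) * Li_int (p - 1) (p + 2*m + 2) y + real (2*m + 1) * Li_int p (p + 2*m + 1) y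
         - real (p + 1) * Li_int (p + 1) (p + 2*m) y)
      - (-1) ^ p * (ln (1 - y) * (ogf c y - ogf c 1))
      - T (p - 1) p (p + 2*m) (p + 2*m + 1) y - T p (p + 1) (p + 2*m - 1) (p + 2*m) y
      + T (p + 2*m + 1) (p + 2*m + 2) (p - 2) (p - 1) y + T (p + 2*m) (p + 2*m + 1) (p - 1) p y" for y
  \<comment> \<open>The interval \<open>{-1..b}\<close> contains the segment from \<open>0\<close>
    to \<open>x\<close> for either sign of \<open>x\<close> and stays below
    \<open>1\<close>.\<close>
  define b where "b = max x 0"
  have b: "0 \<le> b" "b < 1" "x \<le> b" using assms(2) by (auto simp: b_def)
  have c1: "abs_conv 1 c"
    unfolding c_def[abs_def] using assms(1) by (intro abs_conv_add abs_conv_1_zeta_coeff) auto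
  have cr: "abs_conv r c" if "0 \<le> r" "r < 1" for r
    unfolding c_def[abs_def] using that by (intro abs_conv_add abs_conv_zeta_coeff) auto
  have F': "(F has_real_derivative (ogf c 1 - ogf c y) / (1 - y)) (at y within {-1..b})"
    if "y \<in> {-1..b}" for y
    unfolding F_def[abs_def] by (rule partial_log_series_deriv[OF c1 b(1,2) that])
  have I': "(Li_int u v has_real_derivative Li u y * Li v y / y) (at y within {-1..b})"
    if "y \<in> {-1..b}" "u \<ge> 1" "v \<ge> 2" for u v y
    by (rule Li_int_deriv) (use that b in auto)
  have zero: "D x = 0"
  proof (rule eq_zero_of_deriv_zero[of D])
    have "continuous_on {-1..b} F" using F' by (rule DERIV_continuous_on)
    moreover have "continuous_on {-1..b} (Li_int u v)" if "u \<ge> 1" "v \<ge> 2" for u v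
      using I'[OF _ that] by (rule DERIV_continuous_on)
    moreover have "continuous_on {-1..b} (ogf c)"
      by (rule continuous_on_subset[OF continuous_on_ogf[OF c1]]) (use b in auto)
    moreover have "continuous_on {-1..b} (T J e K s)" if "J + 1 \<le> e" "2 \<le> e" "K \<le> s" for J e K s
      unfolding T_def[abs_def]
      by (rule continuous_on_subset[OF continuous_on_telescoping[OF that]]) (use b in auto)
    ultimately have "continuous_on {-1..b} D"
      unfolding D_def[abs_def] using assms(1) b by (intro continuous_intros) auto
    then show "continuous_on (closed_segment 0 x) D"
      by (rule continuous_on_subset)
         (use assms(2) b in \<open>auto simp: closed_segment_eq_real_ivl split: if_splits\<close>)
  next
    fix t assume "t \<in> open_segment 0 x"
    then have t: "\<bar>t\<bar> < 1" "t \<noteq> 0" "-1 < t" "t < 1" "t \<in> {-1..b}" and at: "at t within {-1..b} = at t"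
      using assms(2) by (auto simp: open_segment_eq_real_ivl b_def at_within_Icc_at split: if_splits)
    define E where "E = ogf (\<lambda>n. real n * c n) t"
    \<comment> \<open>The common weight \<open>e + K\<close> at which all four telescoping sums
      end.\<close>
    define N where "N = 2 * p + 2 * m"
    have T': "(T J e K s has_real_derivative
        (Li s t * euler_ser J e t - (-1) ^ K * Li (s - K) t * euler_ser J (e + K) t) / t) (at t)"
      if "J \<le> e" "1 \<le> e" "K \<le> s" for J e K s
      unfolding T_def[abs_def] by (rule telescoping_deriv[OF t(1,2) that])
    have "(ogf c has_real_derivative E / t) (at t)"
      unfolding E_def by (rule ogf_deriv) (use t cr in auto)
    then have "((\<lambda>y. ogf c y - ogf c 1) has_real_derivative E / t) (at t)"
      by (auto intro!: derivative_eq_intros)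
    moreover have "((\<lambda>y. ln (1 - y)) has_real_derivative - 1 / (1 - t)) (at t)"
      using t by (auto intro!: derivative_eq_intros)
    ultimately have "((\<lambda>y. ln (1 - y) * (ogf c y - ogf c 1)) has_real_derivative
        ln (1 - t) * (E / t) + - 1 / (1 - t) * (ogf c t - ogf c 1)) (at t)"
      by (intro DERIV_mult')
    moreover have "ln (1 - t) = - Li 1 t" using Li_1[of t] t by simp
    \<comment> \<open>The second summand is exactly the derivative of \<open>F\<close>, so in
      \<open>D\<close> only the term with \<open>Li 1\<close> survives.\<close>
    ultimately have G': "((\<lambda>y. ln (1 - y) * (ogf c y - ogf c 1)) has_real_derivative
        - Li 1 t * E / t + (ogf c 1 - ogf c t) / (1 - t)) (at t)"
      by (simp add: diff_divide_distrib)
    \<comment> \<open>Both parts of \<open>n * c n\<close> have weight \<open>N\<close>, so each is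
      the top summand \<open>j = J\<close> of a coefficient of weight \<open>N\<close>, that is, a
      difference of two boundary series.\<close>
    have E: "E = (euler_ser p N t - euler_ser (p - 1) N t)
               + (euler_ser (p + 2*m + 1) N t - euler_ser (p + 2*m) N t)"
    proof -
      have "E = ogf (\<lambda>n. zeta_upto n p / real n ^ (N - p) + zeta_upto n (p + 2*m + 1) / real n ^ (N - (p + 2*m + 1))) t"
        unfolding E_def
      proof (rule fun_cong[OF ogf_cong])
        fix n :: nat assume "n \<ge> 1"
        have "real n ^ (p + 2*m + 1) = real n * real n ^ (N - p)"
             "real n ^ p = real n * real n ^ (N - (p + 2*m + 1))"
          using assms(1) by (simp_all add: N_def power_eq_if[of _ p])
        then show "real n * c n = zeta_upto n p / real n ^ (N - p) + zeta_upto n (p + 2*m + 1) / real n ^ (N - (p + 2*m + 1))"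
          using \<open>n \<ge> 1\<close> by (simp add: c_def distrib_left)
      qed
      also have "\<dots> = ogf (\<lambda>n. zeta_upto n p / real n ^ (N - p)) t
                     + ogf (\<lambda>n. zeta_upto n (p + 2*m + 1) / real n ^ (N - (p + 2*m + 1))) t"
        using t by (intro ogf_add[where r = "\<bar>t\<bar>"] abs_conv_zeta_coeff) auto
      finally show ?thesis
        using euler_ser_step[OF t(1), of p N] euler_ser_step[OF t(1), of "p + 2*m + 1" N] assms(1) by simp
    qed
    \<comment> \<open>The derivative is left in the raw form produced by the rules; the facts after
      it normalise indices and signs.\<close>
    have "(D has_real_derivative
        (-1) ^ p * ((ogf c 1 - ogf c t) / (1 - t))
        - (real (p + 2*m + 2) * (Li (p - 1) t * Li (p + 2*m + 2) t / t)
           + real (2*m + 1) * (Li p t * Li (p + 2*m + 1) t / t)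
           - real (p + 1) * (Li (p + 1) t * Li (p + 2*m) t / t))
        - (-1) ^ p * (- Li 1 t * E / t + (ogf c 1 - ogf c t) / (1 - t))
        - (Li (p + 2*m + 1) t * euler_ser (p - 1) p t
             - (-1) ^ (p + 2*m) * Li (p + 2*m + 1 - (p + 2*m)) t * euler_ser (p - 1) (p + (p + 2*m)) t) / t
        - (Li (p + 2*m) t * euler_ser p (p + 1) t
             - (-1) ^ (p + 2*m - 1) * Li (p + 2*m - (p + 2*m - 1)) t * euler_ser p (p + 1 + (p + 2*m - 1)) t) / t
        + (Li (p - 1) t * euler_ser (p + 2*m + 1) (p + 2*m + 2) t
             - (-1) ^ (p - 2) * Li (p - 1 - (p - 2)) t * euler_ser (p + 2*m + 1) (p + 2*m + 2 + (p - 2)) t) / t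
        + (Li p t * euler_ser (p + 2*m) (p + 2*m + 1) t
             - (-1) ^ (p - 1) * Li (p - (p - 1)) t * euler_ser (p + 2*m) (p + 2*m + 1 + (p - 1)) t) / t) (at t)"
      unfolding D_def[abs_def]
      by (intro DERIV_add DERIV_diff DERIV_cmult F'[OF t(5), unfolded at] I'[OF t(5), unfolded at] G' T')
         (use assms(1) in auto)
    moreover have "p + (p + 2*m) = N" "p + 1 + (p + 2*m - 1) = N" "p + 2*m + 2 + (p - 2) = N"
      "p + 2*m + 1 + (p - 1) = N" "p + 2*m + 1 - (p + 2*m) = 1" "p + 2*m - (p + 2*m - 1) = 1"
      "p - 1 - (p - 2) = 1" "p - (p - 1) = 1"
      using assms(1) by (auto simp: N_def)
    moreover have "(-1 :: real) ^ (p + 2*m) = (-1) ^ p" "(-1 :: real) ^ (p + 2*m - 1) = - ((-1) ^ p)"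
      "(-1 :: real) ^ (p - 2) = (-1) ^ p" "(-1 :: real) ^ (p - 1) = - ((-1) ^ p)"
      using assms(1) by (auto simp: minus_one_power_iff)
    \<comment> \<open>After substitution the triple products with \<open>Li 1\<close> cancel in
      pairs. The two products of \<open>Li p\<close> and \<open>Li (p + 2*m + 1)\<close> combine to
      the factor \<open>2*m + 1\<close>, matching the second integral.\<close>
    moreover have "euler_ser (p - 1) p t = real p * Li p t + Li 1 t * Li (p - 1) t"
      "euler_ser p (p + 1) t = real (p + 1) * Li (p + 1) t + Li 1 t * Li p t"
      "euler_ser (p + 2*m + 1) (p + 2*m + 2) t = real (p + 2*m + 2) * Li (p + 2*m + 2) t + Li 1 t * Li (p + 2*m + 1) t"
      "euler_ser (p + 2*m) (p + 2*m + 1) t = real (p + 2*m + 1) * Li (p + 2*m + 1) t + Li 1 t * Li (p + 2*m) t"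
      using euler_ser_eval[of _ t] assms(1) t(1) euler_ser_eval[of "p + 1" t] euler_ser_eval[of "p + 2*m + 2" t]
        euler_ser_eval[of "p + 2*m + 1" t] by simp_all
    ultimately show "(D has_real_derivative 0) (at t)"
      unfolding E by (simp only:) (simp add: algebra_simps add_divide_distrib diff_divide_distrib)
  next
    show "D 0 = 0" unfolding D_def F_def T_def sum_zero_power_divide by simp
  qed
  have G: "ogf c x - ogf c 1 = (\<Sum>n. c (Suc n) * (x ^ Suc n - 1))"
  proof -
    have "summable (\<lambda>n. c (Suc n) * 1 ^ Suc n)" "summable (\<lambda>n. c (Suc n) * x ^ Suc n)"
      by (rule abs_conv_summable[OF c1]; use assms(2) in auto)+
    from suminf_diff[OF this(2,1)] show ?thesis by (simp add: ogf_def right_diff_distrib)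
  qed
  \<comment> \<open>These equations bring the uniform indices of \<open>T\<close> and
    \<open>euler_coeff\<close> into the form used in the statement, so that only linear arithmetic
    over identical terms remains.\<close>
  have idx: "p - 1 + 1 - i = p - i" "p + 2*m + 1 + 1 - i = p + 2*m + 2 - i" "p + 1 + i - 1 = p + i"
    "p + 2*m + 2 + i - 1 = p + 2*m + 1 + i" "p + 2*m + 1 + i - 1 = p + 2*m + i" for i
    using assms(1) by auto
  show ?thesis
    using zero[unfolded D_def G]
    unfolding F_def T_def euler_ser_def ogf_def euler_coeff_def c_def idx mult.assoc
    by linarith
qed

end
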